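(* Let $A$ and $B$ be $n$-dimensional complex pre-Lie algebras. If $A$ degenerates to $B$, then $$\dim \mathrm{Der}_{(\alpha,\beta,\gamma)}(A)\le \dim \mathrm{Der}_{(\alpha,\beta,\gamma)}(B)$$ for all $\alpha,\beta,\gamma\in\mathbb{C}$.
   Context: A pre-Lie algebra over a field $K$ is a $K$-vector space with a bilinear product satisfying $(x\cdot y)\cdot z-x\cdot(y\cdot z)=(y\cdot x)\cdot z-y\cdot(x\cdot z)$ for all $x,y,z$. For $\alpha,\beta,\gamma\in\mathbb{C}$ and a complex pre-Lie algebra $A$, $\mathrm{Der}_{(\alpha,\beta,\gamma)}(A)$ is the space of all $D\in\mathrm{End}(A)$ satisfying $\alpha D(x\cdot y)=\beta D(x)\cdot y+\gamma\, x\cdot D(y)$ for all $x,y\in A$. Fix an $n$-dimensional $K$-vector space $V$ with basis $(e_1,\dots,e_n)$. $\mathcal{P}_n(K)\subseteq K^{n^3}$ is the affine algebraic set of all structure constants $(c_{ij}^k)$ of pre-Lie algebra products $e_i\cdot e_j=\sum_k c_{ij}^k e_k$ on $V$. $GL_n(K)$ acts on it by $(g\circ\mu)(x,y)=g(\mu(g^{-1}x,g^{-1}y))$; orbits correspond to isomorphism classes. $O(\mu)$ is the orbit of $\mu$ and $\overline{O(\mu)}$ its Zariski closure. $\lambda$ degenerates to $\mu$ if $\mu\in\overline{O(\lambda)}$. An algebra $A$ degenerates to $B$ if a structure representing $A$ degenerates to one representing $B$. Here $K=\mathbb{C}$. *)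

theory Defs
  imports Complex_Main "HOL-Library.FuncSet" "HOL-Library.Function_Algebras"
begin

section \<open>Pre-Lie algebras and generalized derivations\<close>

locale pre_Lie_algebra = vector_space scale
  for scale :: "'k::field \<Rightarrow> 'a::ab_group_add \<Rightarrow> 'a" +
  fixes mult :: "'a \<Rightarrow> 'a \<Rightarrow> 'a"
  assumes linear_left: "Vector_Spaces.linear scale scale (\<lambda>x. mult x y)"
    and linear_right: "Vector_Spaces.linear scale scale (\<lambda>y. mult x y)"
    and left_symmetric:
      "mult (mult x y) z - mult x (mult y z) = mult (mult y x) z - mult y (mult x z)"

definition Der :: "('k::field \<Rightarrow> 'a::ab_group_add \<Rightarrow> 'a) \<Rightarrow> ('a \<Rightarrow> 'a \<Rightarrow> 'a)
    \<Rightarrow> 'k \<Rightarrow> 'k \<Rightarrow> 'k \<Rightarrow> ('a \<Rightarrow> 'a) set" where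
  "Der scale mult \<alpha> \<beta> \<gamma> = {D. Vector_Spaces.linear scale scale D \<and>
     (\<forall>x y. scale \<alpha> (D (mult x y)) = scale \<beta> (mult (D x) y) + scale \<gamma> (mult x (D y)))}"

text \<open>Maps \<open>'a \<Rightarrow> 'a\<close> form a vector space under pointwise operations; the additive structure
  is the one of \<^theory>\<open>HOL-Library.Function_Algebras\<close>.\<close>

definition fun_scale :: "('k \<Rightarrow> 'a \<Rightarrow> 'a) \<Rightarrow> 'k \<Rightarrow> ('a \<Rightarrow> 'a) \<Rightarrow> ('a \<Rightarrow> 'a)" where
  "fun_scale scale c D = (\<lambda>x. scale c (D x))"

lemma vector_space_fun_scale:
  assumes "vector_space scale"
  shows "vector_space (fun_scale scale)"
proof -
  interpret vector_space scale by fact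
  show ?thesis
    by unfold_locales
      (simp_all add: fun_scale_def fun_eq_iff scale_right_distrib scale_left_distrib)
qed

lemma (in pre_Lie_algebra) subspace_Der:
  "module.subspace (fun_scale scale) (Der scale mult \<alpha> \<beta> \<gamma>)"
proof -
  interpret F: vector_space "fun_scale scale"
    by (rule vector_space_fun_scale) unfold_locales
  interpret P: vector_space_pair scale scale by unfold_locales
  have ml: "mult (x + x') y = mult x y + mult x' y" "mult (scale c x) y = scale c (mult x y)"
    for x x' y c
    using linear_left[of y] by (simp_all add: Vector_Spaces.linear_iff)
  have mr: "mult x (y + y') = mult x y + mult x y'" "mult x (scale c y) = scale c (mult x y)"
    for x y y' c
    using linear_right[of x] by (simp_all add: Vector_Spaces.linear_iff)
  have m0: "mult 0 y = 0" "mult x 0 = 0" for x y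
    using ml(2)[of 0 0 y] mr(2)[of x 0 0] by simp_all
  have "fun_scale scale c D \<in> Der scale mult \<alpha> \<beta> \<gamma>" if "D \<in> Der scale mult \<alpha> \<beta> \<gamma>" for c D
  proof -
    have D: "scale \<alpha> (D (mult x y)) = scale \<beta> (mult (D x) y) + scale \<gamma> (mult x (D y))" for x y
      using that by (simp add: Der_def)
    have "scale \<alpha> (scale c (D (mult x y))) =
        scale \<beta> (scale c (mult (D x) y)) + scale \<gamma> (scale c (mult x (D y)))" for x y
      using arg_cong[OF D[of x y], of "scale c"]
      by (simp add: scale_right_distrib mult.commute)
    then show ?thesis
      using that
      by (simp add: Der_def Vector_Spaces.linear_iff fun_scale_def ml mr
          scale_right_distrib mult.commute)
  qed
  moreover have "D + D' \<in> Der scale mult \<alpha> \<beta> \<gamma>"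
    if "D \<in> Der scale mult \<alpha> \<beta> \<gamma>" "D' \<in> Der scale mult \<alpha> \<beta> \<gamma>" for D D'
    using that by (simp add: Der_def Vector_Spaces.linear_iff ml mr scale_right_distrib)
  moreover have "0 \<in> Der scale mult \<alpha> \<beta> \<gamma>"
    by (simp add: Der_def Vector_Spaces.linear_iff m0 vector_space_axioms)
  ultimately show ?thesis
    by (simp add: F.subspace_def)
qed

definition dim_Der :: "('k::field \<Rightarrow> 'a::ab_group_add \<Rightarrow> 'a) \<Rightarrow> ('a \<Rightarrow> 'a \<Rightarrow> 'a)
    \<Rightarrow> 'k \<Rightarrow> 'k \<Rightarrow> 'k \<Rightarrow> nat" where
  "dim_Der scale mult \<alpha> \<beta> \<gamma> = vector_space.dim (fun_scale scale) (Der scale mult \<alpha> \<beta> \<gamma>)"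

definition algebra_iso :: "('k::field \<Rightarrow> 'a::ab_group_add \<Rightarrow> 'a) \<Rightarrow> ('a \<Rightarrow> 'a \<Rightarrow> 'a)
    \<Rightarrow> ('k \<Rightarrow> 'b::ab_group_add \<Rightarrow> 'b) \<Rightarrow> ('b \<Rightarrow> 'b \<Rightarrow> 'b) \<Rightarrow> bool" where
  "algebra_iso scaleA multA scaleB multB \<longleftrightarrow>
     (\<exists>\<phi>. Vector_Spaces.linear scaleA scaleB \<phi> \<and> bij \<phi> \<and>
          (\<forall>x y. \<phi> (multA x y) = multB (\<phi> x) (\<phi> y)))"


section \<open>Zariski closure in affine space\<close>

text \<open>The affine space with coordinates indexed by a finite set \<open>I\<close> is \<open>I \<rightarrow>\<^sub>E UNIV\<close>.
  Closed sets are the zero sets of polynomial functions, that is, of the functions on this space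
  generated from the constants and the coordinates by addition and multiplication.\<close>

inductive_set polynomial_functions :: "'i set \<Rightarrow> (('i \<Rightarrow> 'k::field) \<Rightarrow> 'k) set"
  for I :: "'i set" where
  const: "(\<lambda>x. c) \<in> polynomial_functions I"
| coord: "i \<in> I \<Longrightarrow> (\<lambda>x. x i) \<in> polynomial_functions I"
| add: "f \<in> polynomial_functions I \<Longrightarrow> g \<in> polynomial_functions I \<Longrightarrow>
    (\<lambda>x. f x + g x) \<in> polynomial_functions I"
| mult: "f \<in> polynomial_functions I \<Longrightarrow> g \<in> polynomial_functions I \<Longrightarrow>
    (\<lambda>x. f x * g x) \<in> polynomial_functions I"

definition zariski_closed :: "'i set \<Rightarrow> ('i \<Rightarrow> 'k::field) set \<Rightarrow> bool" where
  "zariski_closed I Z \<longleftrightarrow>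
     (\<exists>F \<subseteq> polynomial_functions I. Z = {x \<in> I \<rightarrow>\<^sub>E UNIV. \<forall>f\<in>F. f x = 0})"

definition zariski_closure :: "'i set \<Rightarrow> ('i \<Rightarrow> 'k::field) set \<Rightarrow> ('i \<Rightarrow> 'k) set" where
  "zariski_closure I S = \<Inter>{Z. zariski_closed I Z \<and> S \<subseteq> Z}"


section \<open>Structure constants, orbits and degenerations\<close>

locale vector_space_with_basis = vector_space scale
  for scale :: "'k::field \<Rightarrow> 'v::ab_group_add \<Rightarrow> 'v" +
  fixes n :: nat and e :: "nat \<Rightarrow> 'v"
  assumes inj_basis: "inj_on e {..<n}"
    and independent_basis: "independent (e ` {..<n})"
    and span_basis: "span (e ` {..<n}) = UNIV"

definition has_dimension :: "('k::field \<Rightarrow> 'a::ab_group_add \<Rightarrow> 'a) \<Rightarrow> nat \<Rightarrow> bool" where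
  "has_dimension scale n \<longleftrightarrow> (\<exists>e. vector_space_with_basis scale n e)"

abbreviation structure_index :: "nat \<Rightarrow> (nat \<times> nat \<times> nat) set" where
  "structure_index n \<equiv> {..<n} \<times> {..<n} \<times> {..<n}"

context vector_space_with_basis
begin

text \<open>The entry at \<open>(i, j, k)\<close> is the coefficient of \<open>e k\<close> in \<open>\<mu> (e i) (e j)\<close>.
  Indices run from \<open>0\<close> to \<open>n - 1\<close>.\<close>

definition structure_constants :: "('v \<Rightarrow> 'v \<Rightarrow> 'v) \<Rightarrow> nat \<times> nat \<times> nat \<Rightarrow> 'k" where
  "structure_constants \<mu> = (\<lambda>(i, j, k) \<in> structure_index n.
     representation (e ` {..<n}) (\<mu> (e i) (e j)) (e k))"

definition pre_Lie_variety :: "(nat \<times> nat \<times> nat \<Rightarrow> 'k) set" where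
  "pre_Lie_variety = structure_constants ` {\<mu>. pre_Lie_algebra scale \<mu>}"

definition GL :: "('v \<Rightarrow> 'v) set" where
  "GL = {g. Vector_Spaces.linear scale scale g \<and> bij g}"

definition GL_action :: "('v \<Rightarrow> 'v) \<Rightarrow> ('v \<Rightarrow> 'v \<Rightarrow> 'v) \<Rightarrow> ('v \<Rightarrow> 'v \<Rightarrow> 'v)" where
  "GL_action g \<mu> = (\<lambda>x y. g (\<mu> (inv g x) (inv g y)))"

definition orbit :: "('v \<Rightarrow> 'v \<Rightarrow> 'v) \<Rightarrow> (nat \<times> nat \<times> nat \<Rightarrow> 'k) set" where
  "orbit \<mu> = (\<lambda>g. structure_constants (GL_action g \<mu>)) ` GL"

text \<open>The closure is taken inside the variety of pre-Lie structures, with the topology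
  induced from the affine space of all structure constants.\<close>

definition orbit_closure :: "('v \<Rightarrow> 'v \<Rightarrow> 'v) \<Rightarrow> (nat \<times> nat \<times> nat \<Rightarrow> 'k) set" where
  "orbit_closure \<mu> = pre_Lie_variety \<inter> zariski_closure (structure_index n) (orbit \<mu>)"

definition degenerates :: "('v \<Rightarrow> 'v \<Rightarrow> 'v) \<Rightarrow> ('v \<Rightarrow> 'v \<Rightarrow> 'v) \<Rightarrow> bool" where
  "degenerates \<mu> \<nu> \<longleftrightarrow> structure_constants \<nu> \<in> orbit_closure \<mu>"

text \<open>A pre-Lie product on the fixed space represents an algebra if it makes the space
  isomorphic to that algebra.\<close>

definition represents :: "('v \<Rightarrow> 'v \<Rightarrow> 'v) \<Rightarrow> ('k \<Rightarrow> 'a::ab_group_add \<Rightarrow> 'a)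
    \<Rightarrow> ('a \<Rightarrow> 'a \<Rightarrow> 'a) \<Rightarrow> bool" where
  "represents \<mu> scaleA multA \<longleftrightarrow>
     pre_Lie_algebra scale \<mu> \<and> algebra_iso scale \<mu> scaleA multA"

definition algebra_degenerates :: "('k \<Rightarrow> 'a::ab_group_add \<Rightarrow> 'a) \<Rightarrow> ('a \<Rightarrow> 'a \<Rightarrow> 'a)
    \<Rightarrow> ('k \<Rightarrow> 'b::ab_group_add \<Rightarrow> 'b) \<Rightarrow> ('b \<Rightarrow> 'b \<Rightarrow> 'b) \<Rightarrow> bool" where
  "algebra_degenerates scaleA multA scaleB multB \<longleftrightarrow>
     (\<exists>\<mu> \<nu>. represents \<mu> scaleA multA \<and> represents \<nu> scaleB multB \<and> degenerates \<mu> \<nu>)"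

end

end

theory Submission
  imports Defs
begin

text \<open>
  For a product \<open>m\<close> on \<open>V\<close>, the maps in \<^const>\<open>Der\<close> are the solutions \<open>D\<close> in \<open>End V\<close> of a
  homogeneous linear system whose coefficients are polynomials in the structure constants
  of \<open>m\<close>. The dimension of a solution space is upper semicontinuous in the coefficients of its
  system, since independent equations remain independent on a Zariski neighbourhood. It is also
  constant on \<open>GL\<close>-orbits, since an isomorphism carries derivations to derivations by
  conjugation. If \<open>\<nu>\<close> lies in the closure of the orbit of \<open>\<mu>\<close>, then every neighbourhood of \<open>\<nu>\<close>
  meets that orbit, and comparing \<open>\<nu>\<close> with a point of the orbit near it gives the inequality.

  For the semicontinuity, let \<open>C\<close> be a basis of a complement in \<open>End V\<close> of the derivations of \<open>\<nu>\<close>.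
  Then the defects of the derivation law at the elements of \<open>C\<close>, computed with the product \<open>\<nu>\<close>, are
  linearly independent
  (\<open>independent_family_der_defect_iff\<close>). The vectors of defects have polynomial entries, so they
  are still independent wherever a certain polynomial, nonzero at \<open>\<nu>\<close>, does not vanish
  (\<open>independent_family_open\<close>, by Gaussian elimination). At such a point \<open>m\<close> the span of \<open>C\<close> meets
  the derivations of \<open>m\<close> only in \<open>0\<close>, which leaves for them at most the codimension of that span,
  and this is the dimension of the derivations of \<open>\<nu>\<close>
  (\<open>dim_Der_upper_semicontinuous\<close>).
\<close>

section \<open>Dimension counts in vector spaces\<close>

text \<open>Conjugation by an isomorphism \<open>V \<rightarrow> W\<close> is a linear map between the spaces of all functions
  \<open>V \<rightarrow> V\<close> and \<open>W \<rightarrow> W\<close>, which can have infinite dimension. The lemma therefore covers spaces of any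
  dimension, by mapping a basis to a basis.\<close>

lemma (in vector_space_pair) dim_injective_image:
  assumes "Vector_Spaces.linear s1 s2 f" "inj f"
  shows "vs2.dim (f ` S) = vs1.dim S"
proof -
  interpret f: Vector_Spaces.linear s1 s2 f by fact
  obtain B where B: "B \<subseteq> S" "vs1.independent B" "S \<subseteq> vs1.span B" "card B = vs1.dim S"
    by (rule vs1.basis_exists)
  have "vs2.independent (f ` B)"
    by (rule f.independent_injective_image) (use B assms(2) in \<open>auto intro: inj_on_subset\<close>)
  moreover have "f ` S \<subseteq> vs2.span (f ` B)"
    unfolding f.span_image using B(3) by blast
  moreover have "card (f ` B) = card B"
    using assms(2) by (intro card_image) (auto intro: inj_on_subset)
  ultimately show ?thesis
    using B by (intro vs2.dim_unique) auto
qed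

context vector_space
begin

lemma finite_span_representation:
  assumes "finite C" "x \<in> span C"
  obtains u where "x = (\<Sum>v\<in>C. scale (u v) v)"
  using assms by (auto simp: span_finite)

text \<open>In the next two lemmas \<open>E\<close> plays the role of \<open>End V\<close>, which sits inside the possibly
  infinite-dimensional space of all functions; hence the finite spanning set \<open>T\<close>.\<close>

lemma obtain_complement:
  assumes "finite T" "E \<subseteq> span T" "subspace K" "K \<subseteq> E"
  obtains C where "finite C" "C \<subseteq> E" "independent C" "span C \<inter> K = {0}" "card C + dim K = dim E"
proof -
  obtain B where B: "B \<subseteq> K" "independent B" "K \<subseteq> span B" "card B = dim K"
    by (rule basis_exists)
  obtain B' where B': "B \<subseteq> B'" "B' \<subseteq> E" "independent B'" "E \<subseteq> span B'"
    using maximal_independent_subset_extend[of B E] B assms by blast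
  have fin: "finite B'"
    using independent_span_bound[OF assms(1) B'(3)] B' assms by blast
  have dimE: "card B' = dim E"
    using B' by (intro basis_card_eq_dim) auto
  have finB: "finite B" using fin B' finite_subset by blast
  define C where "C = B' - B"
  have BC: "B' = C \<union> B" "C \<inter> B = {}" "finite C" "C \<subseteq> E" using B' fin by (auto simp: C_def)
  have indC: "independent C" using independent_mono[OF B'(3)] by (simp add: C_def)
  have trivial: "x = 0" if x: "x \<in> span C" "x \<in> K" for x
  proof -
    obtain u where u: "x = (\<Sum>v\<in>C. scale (u v) v)"
      by (rule finite_span_representation[OF BC(3) x(1)])
    have "x \<in> span B" using B(3) x(2) by blast
    then obtain w where w: "x = (\<Sum>v\<in>B. scale (w v) v)"
      by (rule finite_span_representation[OF finB])
    \<comment> \<open>The two expansions of \<open>x\<close> combine to a relation among the elements of the basis \<open>B'\<close>.\<close>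
    let ?z = "\<lambda>v. if v \<in> C then u v else - w v"
    have "(\<Sum>v\<in>B'. scale (?z v) v) = (\<Sum>v\<in>C. scale (?z v) v) + (\<Sum>v\<in>B. scale (?z v) v)"
      unfolding BC(1) using BC finB by (intro sum.union_disjoint) auto
    also have "(\<Sum>v\<in>B. scale (?z v) v) = (\<Sum>v\<in>B. - scale (w v) v)"
      using BC by (intro sum.cong) auto
    also have "\<dots> = - x" unfolding w by (simp add: sum_negf)
    also have "(\<Sum>v\<in>C. scale (?z v) v) = x" unfolding u by simp
    finally have "(\<Sum>v\<in>B'. scale (?z v) v) = 0" by simp
    then have "?z v = 0" if "v \<in> B'" for v
      by (rule independentD[OF B'(3) fin order_refl _ that])
    then have "\<forall>v\<in>C. u v = 0" using BC(1) by (metis UnCI)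
    then show ?thesis unfolding u by simp
  qed
  show ?thesis
  proof (rule that[OF BC(3,4) indC])
    show "span C \<inter> K = {0}"
      using trivial span_zero subspace_0[OF assms(3)] by blast
    show "card C + dim K = dim E"
      using card_Un_disjoint[OF BC(3) finB BC(2)] BC(1) dimE B(4) by metis
  qed
qed

lemma card_add_dim_le:
  assumes "finite T" "E \<subseteq> span T" "subspace K" "K \<subseteq> E"
    and "finite C" "C \<subseteq> E" "independent C" "span C \<inter> K \<subseteq> {0}"
  shows "card C + dim K \<le> dim E"
proof -
  obtain B where B: "B \<subseteq> K" "independent B" "K \<subseteq> span B" "card B = dim K"
    by (rule basis_exists)
  have finB: "finite B"
    using independent_span_bound[OF assms(1) B(2)] B assms by blast
  have disj: "C \<inter> B = {}"
  proof -
    have "C \<inter> B \<subseteq> {0}" using B assms span_base by blast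
    moreover have "0 \<notin> B" using B dependent_zero by blast
    ultimately show ?thesis by blast
  qed
  have "independent (C \<union> B)"
  proof (rule independent_if_scalars_zero)
    fix u x assume 0: "(\<Sum>v\<in>C \<union> B. scale (u v) v) = 0" and x: "x \<in> C \<union> B"
    have eq: "(\<Sum>v\<in>C. scale (u v) v) + (\<Sum>v\<in>B. scale (u v) v) = 0"
      using 0 sum.union_disjoint[OF assms(5) finB disj] by metis
    have "(\<Sum>v\<in>B. scale (u v) v) \<in> K"
      using B by (intro subspace_sum[OF assms(3)] subspace_scale[OF assms(3)]) auto
    then have "(\<Sum>v\<in>C. scale (u v) v) \<in> K"
      using eq subspace_neg[OF assms(3)] by (metis eq_neg_iff_add_eq_0)
    moreover have "(\<Sum>v\<in>C. scale (u v) v) \<in> span C"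
      by (intro span_sum span_scale span_base)
    ultimately have z: "(\<Sum>v\<in>C. scale (u v) v) = 0" using assms(8) by blast
    then have z': "(\<Sum>v\<in>B. scale (u v) v) = 0" using eq by simp
    show "u x = 0"
      using x independentD[OF assms(7,5) order_refl z] independentD[OF B(2) finB order_refl z'] by auto
  qed (use assms finB in auto)
  moreover obtain B' where B': "B' \<subseteq> E" "independent B'" "E \<subseteq> span B'" "card B' = dim E"
    by (rule basis_exists)
  moreover have "finite B'"
    using independent_span_bound[OF assms(1) B'(2)] B' assms by blast
  moreover have "C \<union> B \<subseteq> span B'"
    using B'(3) B(1) assms(4,6) by blast
  ultimately have "card (C \<union> B) \<le> dim E"
    using independent_span_bound[of B' "C \<union> B"] by auto
  then show ?thesis using card_Un_disjoint[OF assms(5) finB disj] B by simp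
qed

end


section \<open>Independence is a Zariski open condition\<close>

text \<open>The vectors are indexed by \<open>J\<close> and have coordinates indexed by \<open>I\<close>. Independence is stated
  for the family and not for its set of values: the vectors will vary with a parameter, and at
  some parameters two of them may coincide.\<close>

definition independent_family :: "'i set \<Rightarrow> 'j set \<Rightarrow> ('j \<Rightarrow> 'i \<Rightarrow> 'k::field) \<Rightarrow> bool" where
  "independent_family I J w \<longleftrightarrow>
     (\<forall>a. (\<forall>i\<in>I. (\<Sum>j\<in>J. a j * w j i) = 0) \<longrightarrow> (\<forall>j\<in>J. a j = 0))"

lemma independent_familyD:
  "independent_family I J w \<Longrightarrow> \<forall>i\<in>I. (\<Sum>j\<in>J. a j * w j i) = 0 \<Longrightarrow> \<forall>j\<in>J. a j = 0"
  unfolding independent_family_def by (drule spec[of _ a]) (rule mp)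

text \<open>One step of Gaussian elimination, with the row \<open>r\<close> and the column \<open>i\<close> as pivot. The rows are
  cleared by cross-multiplication and not by division, so that polynomial entries stay
  polynomial.\<close>

lemma independent_family_insert_iff:
  fixes w :: "'j \<Rightarrow> 'i \<Rightarrow> 'k::field"
  assumes "finite J" "r \<notin> J" "i \<in> I" "w r i \<noteq> 0"
  shows "independent_family I (insert r J) w \<longleftrightarrow>
    independent_family I J (\<lambda>j k. w r i * w j k - w j i * w r k)"
proof
  assume ind: "independent_family I (insert r J) w"
  show "independent_family I J (\<lambda>j k. w r i * w j k - w j i * w r k)"
    unfolding independent_family_def
  proof (intro allI impI)
    fix a assume a: "\<forall>k\<in>I. (\<Sum>j\<in>J. a j * (w r i * w j k - w j i * w r k)) = 0"
    \<comment> \<open>The coefficient of the pivot row collects what the elimination subtracts.\<close>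
    define b where "b j = (if j = r then - (\<Sum>j\<in>J. a j * w j i) else a j * w r i)" for j
    have "(\<Sum>j\<in>insert r J. b j * w j k) = (\<Sum>j\<in>J. a j * (w r i * w j k - w j i * w r k))" for k
    proof -
      have "(\<Sum>j\<in>J. b j * w j k) = (\<Sum>j\<in>J. a j * w r i * w j k)"
        using assms(2) by (intro sum.cong) (auto simp: b_def)
      moreover have "b r * w r k = - (\<Sum>j\<in>J. a j * w j i * w r k)"
        by (simp add: b_def sum_distrib_right)
      ultimately show ?thesis
        using assms(1,2) by (simp add: right_diff_distrib mult.assoc sum_subtractf)
    qed
    then have "\<forall>k\<in>I. (\<Sum>j\<in>insert r J. b j * w j k) = 0"
      using a by simp
    from independent_familyD[OF ind this] have "\<forall>j\<in>insert r J. b j = 0" .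
    then have "b j = 0" "j \<noteq> r" if "j \<in> J" for j using that assms(2) by auto
    then show "\<forall>j\<in>J. a j = 0" using assms(4) by (simp add: b_def)
  qed
next
  assume ind: "independent_family I J (\<lambda>j k. w r i * w j k - w j i * w r k)"
  show "independent_family I (insert r J) w"
    unfolding independent_family_def
  proof (intro allI impI)
    fix a assume "\<forall>k\<in>I. (\<Sum>j\<in>insert r J. a j * w j k) = 0"
    then have a: "a r * w r k + (\<Sum>j\<in>J. a j * w j k) = 0" if "k \<in> I" for k
      using that assms by simp
    have "(\<Sum>j\<in>J. a j * (w r i * w j k - w j i * w r k)) = 0" if "k \<in> I" for k
    proof -
      have "(\<Sum>j\<in>J. a j * (w r i * w j k - w j i * w r k)) =
          w r i * (\<Sum>j\<in>J. a j * w j k) - w r k * (\<Sum>j\<in>J. a j * w j i)"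
        unfolding sum_distrib_left sum_subtractf[symmetric]
        by (intro sum.cong) (simp_all add: algebra_simps)
      also have "\<dots> = w r i * (- (a r * w r k)) - w r k * (- (a r * w r i))"
        using minus_unique[OF a[OF that]] minus_unique[OF a[OF assms(3)]] by simp
      finally show ?thesis by simp
    qed
    then have "\<forall>j\<in>J. a j = 0"
      using independent_familyD[OF ind] by simp
    then show "\<forall>j\<in>insert r J. a j = 0"
      using a[OF assms(3)] assms(4) by auto
  qed
qed

lemma polynomial_functions_diff:
  assumes "f \<in> polynomial_functions X" "g \<in> polynomial_functions X"
  shows "(\<lambda>x. f x - g x) \<in> polynomial_functions X"
  using polynomial_functions.add[OF assms(1)
      polynomial_functions.mult[OF polynomial_functions.const[of "-1"] assms(2)]]
  by simp

lemma polynomial_functions_sum: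
  assumes "\<And>j. j \<in> J \<Longrightarrow> f j \<in> polynomial_functions X"
  shows "(\<lambda>x. \<Sum>j\<in>J. f j x) \<in> polynomial_functions X"
  using assms
  by (induction J rule: infinite_finite_induct)
    (auto intro: polynomial_functions.const polynomial_functions.add)

text \<open>By elimination: the family is independent wherever the pivot entry is nonzero and the
  shorter family of cleared rows is independent. The polynomial \<open>f\<close> is thus the product of
  the successive pivots of the elimination that succeeds at \<open>p\<close>.\<close>

lemma independent_family_open:
  fixes w :: "'j \<Rightarrow> 'i \<Rightarrow> ('x \<Rightarrow> 'k::field) \<Rightarrow> 'k"
  assumes "finite J"
    and "\<And>j i. j \<in> J \<Longrightarrow> i \<in> I \<Longrightarrow> w j i \<in> polynomial_functions X"
    and "independent_family I J (\<lambda>j i. w j i p)"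
  obtains f where "f \<in> polynomial_functions X" "f p \<noteq> 0"
    "\<And>x. f x \<noteq> 0 \<Longrightarrow> independent_family I J (\<lambda>j i. w j i x)"
  using assms
proof (induction J arbitrary: w thesis rule: finite_induct)
  case empty
  show ?case
    by (rule empty(1)[of "\<lambda>_. 1"]) (auto simp: independent_family_def intro: polynomial_functions.const)
next
  case (insert r J)
  \<comment> \<open>A vector of an independent family is nonzero, so the row \<open>r\<close> has a pivot at \<open>p\<close>.\<close>
  have "\<exists>i\<in>I. w r i p \<noteq> 0"
  proof (rule ccontr)
    assume *: "\<not> ?thesis"
    define a :: "'j \<Rightarrow> 'k" where "a j = (if j = r then 1 else 0)" for j
    have "\<forall>i\<in>I. (\<Sum>j\<in>insert r J. a j * w j i p) = 0"
      using * by (auto simp: a_def intro!: sum.neutral)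
    from independent_familyD[OF insert.prems(3) this] have "\<forall>j\<in>insert r J. a j = 0" .
    then show False by (simp add: a_def)
  qed
  then obtain i where i: "i \<in> I" "w r i p \<noteq> 0" by blast
  define w' where "w' j k x = w r i x * w j k x - w j i x * w r k x" for j k x
  have poly: "w' j k \<in> polynomial_functions X" if "j \<in> J" "k \<in> I" for j k
    unfolding w'_def using insert.prems(2) i that
    by (intro polynomial_functions_diff polynomial_functions.mult) auto
  have iff: "independent_family I (insert r J) (\<lambda>j i. w j i x) \<longleftrightarrow>
      independent_family I J (\<lambda>j k. w' j k x)" if "w r i x \<noteq> 0" for x
    unfolding w'_def
    using independent_family_insert_iff[of J r i I "\<lambda>j i. w j i x"] insert.hyps i that by simp
  have "independent_family I J (\<lambda>j k. w' j k p)"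
    using insert.prems(3) iff[OF i(2)] by simp
  from insert.IH[OF _ poly this] obtain f where f: "f \<in> polynomial_functions X" "f p \<noteq> 0"
    "\<And>x. f x \<noteq> 0 \<Longrightarrow> independent_family I J (\<lambda>j k. w' j k x)"
    by metis
  show ?case
  proof (rule insert.prems(1)[of "\<lambda>x. f x * w r i x"])
    show "(\<lambda>x. f x * w r i x) \<in> polynomial_functions X"
      using f insert.prems(2) i by (intro polynomial_functions.mult) auto
    show "f p * w r i p \<noteq> 0" using f i by simp
    show "independent_family I (insert r J) (\<lambda>j i. w j i x)" if "f x * w r i x \<noteq> 0" for x
      using that f iff by simp
  qed
qed

text \<open>The zero set of a single polynomial is closed. If it contained \<open>S\<close>, then it would contain
  the closure of \<open>S\<close>.\<close>

lemma zariski_closure_nonvanishing: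
  assumes "f \<in> polynomial_functions I" "p \<in> zariski_closure I S" "S \<subseteq> I \<rightarrow>\<^sub>E UNIV" "f p \<noteq> 0"
  obtains x where "x \<in> S" "f x \<noteq> 0"
proof -
  have "\<not> S \<subseteq> {x \<in> I \<rightarrow>\<^sub>E UNIV. \<forall>g\<in>{f}. g x = 0}"
  proof
    assume "S \<subseteq> {x \<in> I \<rightarrow>\<^sub>E UNIV. \<forall>g\<in>{f}. g x = 0}"
    moreover have "zariski_closed I {x \<in> I \<rightarrow>\<^sub>E UNIV. \<forall>g\<in>{f}. g x = 0}"
      unfolding zariski_closed_def using assms(1) by blast
    ultimately have "p \<in> {x \<in> I \<rightarrow>\<^sub>E UNIV. \<forall>g\<in>{f}. g x = 0}"
      using assms(2) unfolding zariski_closure_def by blast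
    then show False using assms(4) by simp
  qed
  then show ?thesis using that assms(3) by blast
qed


section \<open>Generalized derivations under isomorphisms\<close>

lemma Der_conjugate:
  assumes \<phi>: "Vector_Spaces.linear sA sB \<phi>" and \<psi>: "Vector_Spaces.linear sB sA \<psi>"
    and inv: "\<And>y. \<phi> (\<psi> y) = y" "\<And>x. \<psi> (\<phi> x) = x"
    and hom: "\<And>x y. \<phi> (mA x y) = mB (\<phi> x) (\<phi> y)"
    and D: "D \<in> Der sA mA \<alpha> \<beta> \<gamma>"
  shows "(\<lambda>y. \<phi> (D (\<psi> y))) \<in> Der sB mB \<alpha> \<beta> \<gamma>"
proof -
  have eq: "sA \<alpha> (D (mA x y)) = sA \<beta> (mA (D x) y) + sA \<gamma> (mA x (D y))" for x y
    using D by (simp add: Der_def)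
  have hom': "\<psi> (mB x y) = mA (\<psi> x) (\<psi> y)" for x y
    by (metis hom inv)
  have "sB \<alpha> (\<phi> (D (\<psi> (mB x y)))) =
      sB \<beta> (mB (\<phi> (D (\<psi> x))) y) + sB \<gamma> (mB x (\<phi> (D (\<psi> y))))" for x y
    using arg_cong[OF eq[of "\<psi> x" "\<psi> y"], of \<phi>] \<phi>
    by (simp add: Vector_Spaces.linear_iff hom hom' inv)
  then show ?thesis
    using D \<phi> \<psi> by (simp add: Der_def Vector_Spaces.linear_iff)
qed

lemma linear_inv:
  assumes "Vector_Spaces.linear sA sB \<phi>" "bij \<phi>"
  shows "Vector_Spaces.linear sB sA (inv \<phi>)"
proof -
  have \<phi>: "\<phi> (x + y) = \<phi> x + \<phi> y" "\<phi> (sA c x) = sB c (\<phi> x)" "\<phi> (inv \<phi> z) = z" for x y c z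
    using assms by (simp_all add: Vector_Spaces.linear_iff bij_is_surj surj_f_inv_f)
  have "inv \<phi> (x + y) = inv \<phi> x + inv \<phi> y" "inv \<phi> (sB c x) = sA c (inv \<phi> x)" for x y c
    by (rule inv_f_eq[OF bij_is_inj[OF assms(2)]], simp only: \<phi>)+
  then show ?thesis using assms by (simp add: Vector_Spaces.linear_iff)
qed

lemma dim_Der_eq_if_algebra_iso:
  assumes "algebra_iso sA mA sB mB"
  shows "dim_Der sA mA \<alpha> \<beta> \<gamma> = dim_Der sB mB \<alpha> \<beta> \<gamma>"
proof -
  obtain \<phi> where \<phi>: "Vector_Spaces.linear sA sB \<phi>" "bij \<phi>"
    and hom: "\<And>x y. \<phi> (mA x y) = mB (\<phi> x) (\<phi> y)"
    using assms unfolding algebra_iso_def by (elim exE conjE) simp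
  define \<psi> where "\<psi> = inv \<phi>"
  have \<psi>: "Vector_Spaces.linear sB sA \<psi>" unfolding \<psi>_def by (rule linear_inv[OF \<phi>])
  have inv: "\<And>y. \<phi> (\<psi> y) = y" "\<And>x. \<psi> (\<phi> x) = x"
    using \<phi> by (simp_all add: \<psi>_def bij_is_surj surj_f_inv_f bij_is_inj inv_f_f)
  have hom': "\<psi> (mB x y) = mA (\<psi> x) (\<psi> y)" for x y
    by (metis hom inv)
  define conj where "conj D = (\<lambda>y. \<phi> (D (\<psi> y)))" for D
  have vs: "vector_space sA" "vector_space sB"
    using \<phi> by (simp_all add: Vector_Spaces.linear_iff)
  interpret vector_space_pair "fun_scale sA" "fun_scale sB"
    using vs by (intro vector_space_pair.intro vector_space_fun_scale)
  have \<phi>_linear: "\<phi> (x + y) = \<phi> x + \<phi> y" "\<phi> (sA c x) = sB c (\<phi> x)" for x y c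
    using \<phi>(1) by (simp_all add: Vector_Spaces.linear_iff)
  have lin: "Vector_Spaces.linear (fun_scale sA) (fun_scale sB) conj"
    unfolding Vector_Spaces.linear_iff
  proof (intro conjI allI)
    show "conj (D + D') = conj D + conj D'" "conj (fun_scale sA c D) = fun_scale sB c (conj D)"
      for D D' c
      by (simp_all add: conj_def fun_scale_def fun_eq_iff \<phi>_linear)
  qed unfold_locales
  have inj: "inj conj"
  proof (rule injI)
    fix D D' assume "conj D = conj D'"
    then have "\<psi> (conj D (\<phi> x)) = \<psi> (conj D' (\<phi> x))" for x by (simp only:)
    then show "D = D'" by (simp add: conj_def inv fun_eq_iff)
  qed
  have "conj ` Der sA mA \<alpha> \<beta> \<gamma> = Der sB mB \<alpha> \<beta> \<gamma>"
  proof
    show "conj ` Der sA mA \<alpha> \<beta> \<gamma> \<subseteq> Der sB mB \<alpha> \<beta> \<gamma>"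
      unfolding conj_def
      by (rule image_subsetI) (rule Der_conjugate[where mA = mA and mB = mB, OF \<phi>(1) \<psi> inv hom])
    show "Der sB mB \<alpha> \<beta> \<gamma> \<subseteq> conj ` Der sA mA \<alpha> \<beta> \<gamma>"
    proof
      fix D assume "D \<in> Der sB mB \<alpha> \<beta> \<gamma>"
      then have mem: "(\<lambda>x. \<psi> (D (\<phi> x))) \<in> Der sA mA \<alpha> \<beta> \<gamma>"
        by (rule Der_conjugate[where mA = mB and mB = mA, OF \<psi> \<phi>(1) inv(2,1) hom'])
      have "D = conj (\<lambda>x. \<psi> (D (\<phi> x)))" by (simp add: conj_def inv)
      then show "D \<in> conj ` Der sA mA \<alpha> \<beta> \<gamma>" using mem by (rule image_eqI)
    qed
  qed
  then show ?thesis
    using dim_injective_image[OF lin inj, of "Der sA mA \<alpha> \<beta> \<gamma>"] by (simp add: dim_Der_def)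
qed


section \<open>The linear system for generalized derivations\<close>

lemma sum_fun_scale_apply:
  "(\<Sum>D\<in>C. fun_scale s (a D) D) x = (\<Sum>D\<in>C. s (a D) (D x))"
  by (induction C rule: infinite_finite_induct) (simp_all add: fun_scale_def)

lemma Der_subset_linear: "Der s m \<alpha> \<beta> \<gamma> \<subseteq> {D. Vector_Spaces.linear s s D}"
  by (auto simp: Der_def)

context vector_space_with_basis
begin

definition coord :: "'v \<Rightarrow> nat \<Rightarrow> 'k" where
  "coord v k = representation (e ` {..<n}) v (e k)"

lemma coord_add: "coord (u + v) k = coord u k + coord v k"
  and coord_diff: "coord (u - v) k = coord u k - coord v k"
  and coord_scale: "coord (scale c v) k = c * coord v k"
  and coord_zero: "coord 0 k = 0"
  and coord_sum: "coord (sum g J) k = (\<Sum>j\<in>J. coord (g j) k)"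
  using independent_basis span_basis
  by (simp_all add: coord_def representation_add representation_diff representation_scale
      representation_zero representation_sum)

lemma sum_coord: "(\<Sum>l<n. scale (coord v l) (e l)) = v"
proof -
  have "(\<Sum>b\<in>e ` {..<n}. scale (representation (e ` {..<n}) v b) b) = v"
    using independent_basis span_basis by (intro sum_representation_eq) auto
  then show ?thesis by (simp add: sum.reindex[OF inj_basis] coord_def)
qed

lemma linear_expand:
  assumes "Vector_Spaces.linear scale scale f"
  shows "f v = (\<Sum>l<n. scale (coord v l) (f (e l)))"
proof -
  interpret f: Vector_Spaces.linear scale scale f by fact
  show ?thesis
    by (subst sum_coord[of v, symmetric]) (simp add: f.sum f.scale)
qed

lemma structure_constants_eq:
  "i < n \<Longrightarrow> j < n \<Longrightarrow> k < n \<Longrightarrow> structure_constants m (i, j, k) = coord (m (e i) (e j)) k"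
  by (simp add: structure_constants_def coord_def)

text \<open>The matrix units span the endomorphisms.\<close>

lemma linear_maps_finite_span:
  obtains T where "finite T"
    "{D. Vector_Spaces.linear scale scale D} \<subseteq> module.span (fun_scale scale) T"
proof -
  interpret F: vector_space "fun_scale scale"
    by (rule vector_space_fun_scale) unfold_locales
  define E where "E = (\<lambda>(i, j) v. scale (coord v i) (e j))"
  have "D \<in> F.span (E ` ({..<n} \<times> {..<n}))" if D: "Vector_Spaces.linear scale scale D" for D
  proof -
    have sum_apply: "sum g J x = (\<Sum>j\<in>J. g j x)" for g :: "nat \<Rightarrow> 'v \<Rightarrow> 'v" and J x
      by (induction J rule: infinite_finite_induct) auto
    have "D v = (\<Sum>i<n. \<Sum>j<n. fun_scale scale (coord (D (e i)) j) (E (i, j))) v" for v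
    proof -
      have "D v = (\<Sum>i<n. scale (coord v i) (\<Sum>j<n. scale (coord (D (e i)) j) (e j)))"
        by (simp add: sum_coord linear_expand[OF D, of v])
      then show ?thesis
        by (simp add: sum_apply fun_scale_def E_def scale_sum_right mult.commute)
    qed
    then have "D = (\<Sum>i<n. \<Sum>j<n. fun_scale scale (coord (D (e i)) j) (E (i, j)))" by (rule ext)
    also have "\<dots> \<in> F.span (E ` ({..<n} \<times> {..<n}))"
      by (intro F.span_sum F.span_scale F.span_base) auto
    finally show ?thesis .
  qed
  then show ?thesis using that[of "E ` ({..<n} \<times> {..<n})"] by auto
qed

text \<open>At the structure constants \<open>c\<close> of a product, this is the coefficient of \<open>e k\<close> in
  \<open>\<alpha> D(e i \<cdot> e j) - \<beta> D(e i) \<cdot> e j - \<gamma> e i \<cdot> D(e j)\<close>. It is written for an arbitrary point \<open>c\<close> of the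
  affine space, so that it is visibly polynomial in \<open>c\<close>.\<close>

definition der_defect :: "'k \<Rightarrow> 'k \<Rightarrow> 'k \<Rightarrow> ('v \<Rightarrow> 'v) \<Rightarrow> nat \<times> nat \<times> nat
    \<Rightarrow> (nat \<times> nat \<times> nat \<Rightarrow> 'k) \<Rightarrow> 'k" where
  "der_defect \<alpha> \<beta> \<gamma> D = (\<lambda>(i, j, k) c.
     \<alpha> * (\<Sum>l<n. c (i, j, l) * coord (D (e l)) k)
     - \<beta> * (\<Sum>l<n. coord (D (e i)) l * c (l, j, k))
     - \<gamma> * (\<Sum>l<n. coord (D (e j)) l * c (i, l, k)))"

lemma der_defect_polynomial:
  assumes "t \<in> structure_index n"
  shows "der_defect \<alpha> \<beta> \<gamma> D t \<in> polynomial_functions (structure_index n)"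
proof -
  obtain i j k where t: "t = (i, j, k)" "i < n" "j < n" "k < n" using assms by auto
  show ?thesis
    unfolding t der_defect_def prod.case using t
    by (intro polynomial_functions_diff polynomial_functions.mult polynomial_functions_sum
        polynomial_functions.const polynomial_functions.coord) auto
qed

lemma der_defect_add:
  "der_defect \<alpha> \<beta> \<gamma> (D + D') t c = der_defect \<alpha> \<beta> \<gamma> D t c + der_defect \<alpha> \<beta> \<gamma> D' t c"
  by (cases t) (simp add: der_defect_def coord_add algebra_simps sum.distrib)

lemma der_defect_scale:
  "der_defect \<alpha> \<beta> \<gamma> (fun_scale scale a D) t c = a * der_defect \<alpha> \<beta> \<gamma> D t c"
  by (cases t)
    (simp add: der_defect_def fun_scale_def coord_scale right_diff_distrib sum_distrib_left
      mult.assoc mult.left_commute)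

lemma der_defect_sum:
  "der_defect \<alpha> \<beta> \<gamma> (\<Sum>D\<in>C. fun_scale scale (a D) D) t c = (\<Sum>D\<in>C. a D * der_defect \<alpha> \<beta> \<gamma> D t c)"
proof -
  have "der_defect \<alpha> \<beta> \<gamma> 0 t c = 0"
    by (cases t) (simp add: der_defect_def coord_zero)
  then show ?thesis
    by (induction C rule: infinite_finite_induct)
      (simp_all add: der_defect_add der_defect_scale)
qed

text \<open>The difference \<open>\<Delta>\<close> of the two sides of the derivation law is bilinear, so it vanishes as
  soon as it vanishes on pairs of basis vectors.\<close>

lemma Der_iff_der_defect_zero:
  assumes m: "pre_Lie_algebra scale m" and D: "Vector_Spaces.linear scale scale D"
  shows "D \<in> Der scale m \<alpha> \<beta> \<gamma> \<longleftrightarrow>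
    (\<forall>t\<in>structure_index n. der_defect \<alpha> \<beta> \<gamma> D t (structure_constants m) = 0)"
proof -
  interpret m: pre_Lie_algebra scale m by fact
  interpret P: vector_space_pair scale scale by unfold_locales
  define \<Delta> where
    "\<Delta> x y = scale \<alpha> (D (m x y)) - scale \<beta> (m (D x) y) - scale \<gamma> (m x (D y))" for x y
  have \<Delta>_left: "Vector_Spaces.linear scale scale (\<lambda>x. \<Delta> x y)" for y
    using D m.linear_left m.linear_right unfolding \<Delta>_def
    by (simp add: Vector_Spaces.linear_iff scale_right_distrib scale_right_diff_distrib mult.commute)
  have \<Delta>_right: "Vector_Spaces.linear scale scale (\<Delta> x)" for x
    using D m.linear_left m.linear_right unfolding \<Delta>_def
    by (simp add: Vector_Spaces.linear_iff scale_right_distrib scale_right_diff_distrib mult.commute)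
  have coord_\<Delta>: "coord (\<Delta> (e i) (e j)) k = der_defect \<alpha> \<beta> \<gamma> D (i, j, k) (structure_constants m)"
    if "i < n" "j < n" "k < n" for i j k
  proof -
    have "coord (D (m (e i) (e j))) k = (\<Sum>l<n. coord (m (e i) (e j)) l * coord (D (e l)) k)"
      by (subst linear_expand[OF D]) (simp add: coord_sum coord_scale)
    moreover have "coord (m (D (e i)) (e j)) k = (\<Sum>l<n. coord (D (e i)) l * coord (m (e l) (e j)) k)"
      by (subst linear_expand[OF m.linear_left]) (simp add: coord_sum coord_scale)
    moreover have "coord (m (e i) (D (e j))) k = (\<Sum>l<n. coord (D (e j)) l * coord (m (e i) (e l)) k)"
      by (subst linear_expand[OF m.linear_right]) (simp add: coord_sum coord_scale)
    ultimately show ?thesis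
      using that
      by (simp add: \<Delta>_def der_defect_def coord_diff coord_scale structure_constants_eq)
  qed
  have "D \<in> Der scale m \<alpha> \<beta> \<gamma> \<longleftrightarrow> (\<forall>x y. \<Delta> x y = 0)"
    using D by (auto simp: Der_def \<Delta>_def algebra_simps)
  also have "\<dots> \<longleftrightarrow> (\<forall>i<n. \<forall>j<n. \<Delta> (e i) (e j) = 0)"
  proof safe
    fix x y assume 0: "\<forall>i<n. \<forall>j<n. \<Delta> (e i) (e j) = 0"
    have "\<Delta> x y = (\<Sum>i<n. scale (coord x i) (\<Sum>j<n. scale (coord y j) (\<Delta> (e i) (e j))))"
      by (subst linear_expand[OF \<Delta>_left], subst linear_expand[OF \<Delta>_right]) simp
    then show "\<Delta> x y = 0" using 0 by simp
  qed auto
  also have "\<dots> \<longleftrightarrow> (\<forall>i<n. \<forall>j<n. \<forall>k<n. coord (\<Delta> (e i) (e j)) k = 0)"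
  proof safe
    fix i j assume "\<forall>i<n. \<forall>j<n. \<forall>k<n. coord (\<Delta> (e i) (e j)) k = 0" "i < n" "j < n"
    then show "\<Delta> (e i) (e j) = 0"
      by (subst sum_coord[symmetric]) simp
  qed (auto simp: coord_zero)
  also have "\<dots> \<longleftrightarrow> (\<forall>t\<in>structure_index n. der_defect \<alpha> \<beta> \<gamma> D t (structure_constants m) = 0)"
    by (auto simp: coord_\<Delta>)
  finally show ?thesis .
qed

text \<open>The defect is linear in \<open>D\<close> and its kernel in \<open>End V\<close> is the space of derivations. Therefore a
  vanishing combination of the defects of \<open>C\<close> is the same as a combination of \<open>C\<close> that is a
  derivation.\<close>

lemma independent_family_der_defect_iff:
  assumes m: "pre_Lie_algebra scale m" and "finite C"
    and lin: "\<And>D. D \<in> C \<Longrightarrow> Vector_Spaces.linear scale scale D"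
  shows "independent_family (structure_index n) C
      (\<lambda>D t. der_defect \<alpha> \<beta> \<gamma> D t (structure_constants m)) \<longleftrightarrow>
    \<not> module.dependent (fun_scale scale) C \<and>
      module.span (fun_scale scale) C \<inter> Der scale m \<alpha> \<beta> \<gamma> \<subseteq> {0}"
proof -
  interpret F: vector_space "fun_scale scale"
    by (rule vector_space_fun_scale) unfold_locales
  interpret m: pre_Lie_algebra scale m by fact
  let ?s = "\<lambda>a. \<Sum>D\<in>C. fun_scale scale (a D) D"
  have lin': "D (x + y) = D x + D y" "D (scale c x) = scale c (D x)" if "D \<in> C" for D x y c
    using lin[OF that] by (simp_all add: Vector_Spaces.linear_iff)
  have lin_s: "Vector_Spaces.linear scale scale (?s a)" for a
    unfolding Vector_Spaces.linear_iff
    by (simp add: sum_fun_scale_apply lin' scale_right_distrib sum.distrib scale_sum_right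
        mult.commute vector_space_axioms cong: sum.cong)
  have "(\<forall>t\<in>structure_index n. (\<Sum>D\<in>C. a D * der_defect \<alpha> \<beta> \<gamma> D t (structure_constants m)) = 0)
      \<longleftrightarrow> ?s a \<in> Der scale m \<alpha> \<beta> \<gamma>" for a
    using Der_iff_der_defect_zero[OF m lin_s] by (simp only: der_defect_sum)
  then have ind_iff: "independent_family (structure_index n) C
      (\<lambda>D t. der_defect \<alpha> \<beta> \<gamma> D t (structure_constants m)) \<longleftrightarrow>
      (\<forall>a. ?s a \<in> Der scale m \<alpha> \<beta> \<gamma> \<longrightarrow> (\<forall>D\<in>C. a D = 0))"
    unfolding independent_family_def by simp
  show ?thesis
  proof
    assume "independent_family (structure_index n) C
      (\<lambda>D t. der_defect \<alpha> \<beta> \<gamma> D t (structure_constants m))"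
    then have *: "\<forall>a. ?s a \<in> Der scale m \<alpha> \<beta> \<gamma> \<longrightarrow> (\<forall>D\<in>C. a D = 0)"
      by (simp only: ind_iff)
    have a0: "\<forall>D\<in>C. a D = 0" if "?s a \<in> Der scale m \<alpha> \<beta> \<gamma>" for a
      using spec[OF *, of a] that by (rule mp)
    have "F.independent C"
    proof (rule F.independent_if_scalars_zero[OF assms(2)])
      fix a D assume 0: "?s a = 0" and "D \<in> C"
      have "?s a \<in> Der scale m \<alpha> \<beta> \<gamma>"
        unfolding 0 by (rule F.subspace_0[OF m.subspace_Der])
      from a0[OF this] show "a D = 0" using \<open>D \<in> C\<close> by blast
    qed
    moreover have "x = 0" if xC: "x \<in> F.span C" and xD: "x \<in> Der scale m \<alpha> \<beta> \<gamma>" for x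
    proof -
      obtain a where x: "x = ?s a"
        by (rule F.finite_span_representation[OF assms(2) xC])
      with a0[of a] xD have "\<forall>D\<in>C. a D = 0" by simp
      then show "x = 0" unfolding x by simp
    qed
    ultimately show "F.independent C \<and> F.span C \<inter> Der scale m \<alpha> \<beta> \<gamma> \<subseteq> {0}" by blast
  next
    assume C: "F.independent C \<and> F.span C \<inter> Der scale m \<alpha> \<beta> \<gamma> \<subseteq> {0}"
    have "\<forall>D\<in>C. a D = 0" if "?s a \<in> Der scale m \<alpha> \<beta> \<gamma>" for a
    proof -
      have "?s a \<in> F.span C" by (intro F.span_sum F.span_scale F.span_base)
      then have "?s a = 0" using that C by blast
      from F.independentD[OF conjunct1[OF C] assms(2) order_refl this] show ?thesis by simp
    qed
    then show "independent_family (structure_index n) C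
      (\<lambda>D t. der_defect \<alpha> \<beta> \<gamma> D t (structure_constants m))"
      unfolding ind_iff by (intro allI impI)
  qed
qed

text \<open>Upper semicontinuity at \<open>\<nu>\<close>: the set \<open>f \<noteq> 0\<close> is the neighbourhood of \<open>\<nu>\<close>. The set \<open>C\<close> is chosen as
  a complement for \<open>\<nu>\<close> and then kept fixed while the product varies.\<close>

lemma dim_Der_upper_semicontinuous:
  assumes \<nu>: "pre_Lie_algebra scale \<nu>"
  obtains f where "f \<in> polynomial_functions (structure_index n)" "f (structure_constants \<nu>) \<noteq> 0"
    "\<And>m. pre_Lie_algebra scale m \<Longrightarrow> f (structure_constants m) \<noteq> 0 \<Longrightarrow>
      dim_Der scale m \<alpha> \<beta> \<gamma> \<le> dim_Der scale \<nu> \<alpha> \<beta> \<gamma>"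
proof -
  interpret F: vector_space "fun_scale scale"
    by (rule vector_space_fun_scale) unfold_locales
  let ?E = "{D. Vector_Spaces.linear scale scale D}"
  obtain T where T: "finite T" "?E \<subseteq> F.span T" by (rule linear_maps_finite_span)
  obtain C where C: "finite C" "C \<subseteq> ?E" "F.independent C" "F.span C \<inter> Der scale \<nu> \<alpha> \<beta> \<gamma> = {0}"
    "card C + F.dim (Der scale \<nu> \<alpha> \<beta> \<gamma>) = F.dim ?E"
    by (rule F.obtain_complement[OF T pre_Lie_algebra.subspace_Der[OF \<nu>] Der_subset_linear])
  have lin: "\<And>D. D \<in> C \<Longrightarrow> Vector_Spaces.linear scale scale D" using C by blast
  note iff = independent_family_der_defect_iff[OF _ C(1) lin]
  have ind: "independent_family (structure_index n) C
      (\<lambda>D t. der_defect \<alpha> \<beta> \<gamma> D t (structure_constants \<nu>))"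
    using iff[OF \<nu>] C by auto
  obtain f where f: "f \<in> polynomial_functions (structure_index n)" "f (structure_constants \<nu>) \<noteq> 0"
    "\<And>c. f c \<noteq> 0 \<Longrightarrow> independent_family (structure_index n) C (\<lambda>D t. der_defect \<alpha> \<beta> \<gamma> D t c)"
    by (rule independent_family_open[where w = "der_defect \<alpha> \<beta> \<gamma>",
          OF C(1) der_defect_polynomial ind]) auto
  show ?thesis
  proof (rule that[OF f(1,2)])
    fix m assume m: "pre_Lie_algebra scale m" "f (structure_constants m) \<noteq> 0"
    have "card C + F.dim (Der scale m \<alpha> \<beta> \<gamma>) \<le> F.dim ?E"
      using iff[OF m(1)] f(3)[OF m(2)] C
      by (intro F.card_add_dim_le[OF T pre_Lie_algebra.subspace_Der[OF m(1)] Der_subset_linear]) auto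
    then show "dim_Der scale m \<alpha> \<beta> \<gamma> \<le> dim_Der scale \<nu> \<alpha> \<beta> \<gamma>"
      using C(5) by (simp add: dim_Der_def)
  qed
qed

lemma algebra_iso_GL_action:
  assumes "g \<in> GL"
  shows "algebra_iso scale \<mu> scale (GL_action g \<mu>)"
  using assms unfolding algebra_iso_def GL_def GL_action_def
  by (auto simp: bij_is_inj inv_f_f intro!: exI[of _ g])

lemma pre_Lie_algebra_GL_action:
  assumes "pre_Lie_algebra scale \<mu>" "g \<in> GL"
  shows "pre_Lie_algebra scale (GL_action g \<mu>)"
proof -
  interpret \<mu>: pre_Lie_algebra scale \<mu> by fact
  have g: "Vector_Spaces.linear scale scale g" "bij g" using assms(2) by (auto simp: GL_def)
  have ig: "Vector_Spaces.linear scale scale (inv g)" by (rule linear_inv[OF g])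
  interpret g: Vector_Spaces.linear scale scale g by fact
  have inv: "inv g (g x) = x" for x using g by (simp add: bij_is_inj inv_f_f)
  show ?thesis
  proof (intro pre_Lie_algebra.intro pre_Lie_algebra_axioms.intro vector_space_axioms)
    show "Vector_Spaces.linear scale scale (\<lambda>x. GL_action g \<mu> x y)"
      "Vector_Spaces.linear scale scale (\<lambda>x. GL_action g \<mu> y x)" for y
      using g(1) ig \<mu>.linear_left \<mu>.linear_right
      by (simp_all add: GL_action_def Vector_Spaces.linear_iff)
    show "GL_action g \<mu> (GL_action g \<mu> x y) z - GL_action g \<mu> x (GL_action g \<mu> y z) =
        GL_action g \<mu> (GL_action g \<mu> y x) z - GL_action g \<mu> y (GL_action g \<mu> x z)" for x y z
      by (simp add: GL_action_def inv g.diff[symmetric] \<mu>.left_symmetric[of "inv g x"])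
  qed
qed

text \<open>The neighbourhood of \<open>\<nu>\<close> given by semicontinuity contains some \<open>g \<circ> \<mu>\<close>, an algebra isomorphic
  to the one of \<open>\<mu>\<close>.\<close>

lemma dim_Der_le_if_degenerates:
  assumes \<mu>: "pre_Lie_algebra scale \<mu>" and \<nu>: "pre_Lie_algebra scale \<nu>" and "degenerates \<mu> \<nu>"
  shows "dim_Der scale \<mu> \<alpha> \<beta> \<gamma> \<le> dim_Der scale \<nu> \<alpha> \<beta> \<gamma>"
proof -
  obtain f where f: "f \<in> polynomial_functions (structure_index n)" "f (structure_constants \<nu>) \<noteq> 0"
    "\<And>m. pre_Lie_algebra scale m \<Longrightarrow> f (structure_constants m) \<noteq> 0 \<Longrightarrow>
      dim_Der scale m \<alpha> \<beta> \<gamma> \<le> dim_Der scale \<nu> \<alpha> \<beta> \<gamma>"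
    by (rule dim_Der_upper_semicontinuous[where \<alpha> = \<alpha> and \<beta> = \<beta> and \<gamma> = \<gamma>, OF \<nu>]) auto
  have "orbit \<mu> \<subseteq> structure_index n \<rightarrow>\<^sub>E UNIV"
    unfolding orbit_def structure_constants_def
    by (rule image_subsetI) (subst restrict_PiE_iff, simp)
  moreover have "structure_constants \<nu> \<in> zariski_closure (structure_index n) (orbit \<mu>)"
    using assms(3) by (simp add: degenerates_def orbit_closure_def)
  ultimately obtain x where "x \<in> orbit \<mu>" "f x \<noteq> 0"
    using zariski_closure_nonvanishing[OF f(1)] f(2) by blast
  then obtain g where g: "g \<in> GL" "f (structure_constants (GL_action g \<mu>)) \<noteq> 0"
    by (auto simp: orbit_def)
  have "dim_Der scale \<mu> \<alpha> \<beta> \<gamma> = dim_Der scale (GL_action g \<mu>) \<alpha> \<beta> \<gamma>"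
    by (rule dim_Der_eq_if_algebra_iso[OF algebra_iso_GL_action[OF g(1)]])
  also have "\<dots> \<le> dim_Der scale \<nu> \<alpha> \<beta> \<gamma>"
    by (rule f(3)[OF pre_Lie_algebra_GL_action[OF \<mu> g(1)] g(2)])
  finally show ?thesis .
qed

end

theorem lemma3p8:
  fixes n :: nat
    and scaleV :: "complex \<Rightarrow> 'v::ab_group_add \<Rightarrow> 'v" and e :: "nat \<Rightarrow> 'v"
    and scaleA :: "complex \<Rightarrow> 'a::ab_group_add \<Rightarrow> 'a" and multA :: "'a \<Rightarrow> 'a \<Rightarrow> 'a"
    and scaleB :: "complex \<Rightarrow> 'b::ab_group_add \<Rightarrow> 'b" and multB :: "'b \<Rightarrow> 'b \<Rightarrow> 'b"
    and \<alpha> \<beta> \<gamma> :: complex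
  assumes "vector_space_with_basis scaleV n e"
    and "pre_Lie_algebra scaleA multA" and "has_dimension scaleA n"
    and "pre_Lie_algebra scaleB multB" and "has_dimension scaleB n"
    and "vector_space_with_basis.algebra_degenerates scaleV n e scaleA multA scaleB multB"
  shows "dim_Der scaleA multA \<alpha> \<beta> \<gamma> \<le> dim_Der scaleB multB \<alpha> \<beta> \<gamma>"
proof -
  interpret vector_space_with_basis scaleV n e by fact
  obtain \<mu> \<nu> where \<mu>: "represents \<mu> scaleA multA" and \<nu>: "represents \<nu> scaleB multB"
    and deg: "degenerates \<mu> \<nu>"
    using assms(6) unfolding algebra_degenerates_def by blast
  have "dim_Der scaleA multA \<alpha> \<beta> \<gamma> = dim_Der scaleV \<mu> \<alpha> \<beta> \<gamma>"
    using \<mu> dim_Der_eq_if_algebra_iso[of scaleV \<mu> scaleA multA] by (simp add: represents_def)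
  also have "\<dots> \<le> dim_Der scaleV \<nu> \<alpha> \<beta> \<gamma>"
    using \<mu> \<nu> deg by (intro dim_Der_le_if_degenerates) (simp_all add: represents_def)
  also have "\<dots> = dim_Der scaleB multB \<alpha> \<beta> \<gamma>"
    using \<nu> dim_Der_eq_if_algebra_iso[of scaleV \<nu> scaleB multB] by (simp add: represents_def)
  finally show ?thesis .
qed

end
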